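(* Let $f:\Omega\to\mathbb{O}$ be a slice regular function and fix $x_0\in\Omega_J\setminus\mathbb{R}$, where $J\in\mathbb{S}$ and $\Omega_J=\Omega\cap\mathbb{C}_J$. If $f'_s(x_0)\neq0$ and $f'_c(x_0)f'_s(x_0)^{-1}\notin\mathbb{C}_J^\perp$, then setting $$\mathcal{J}_0(p+q):=Jp+\big(J(q f'_s(x_0)^{-1})\big)f'_s(x_0)$$ for all $p\in\mathbb{C}_J\,f'_c(x_0)$ and all $q\in\mathbb{C}_J^\perp\,f'_s(x_0)$ defines a constant complex structure on $$\mathbb{O}=\mathbb{C}_J\,f'_c(x_0)\oplus\mathbb{C}_J^\perp\,f'_s(x_0)$$ such that $$\mathcal{J}_0\circ df_{x_0}=df_{x_0}\circ\mathbb{J}_{x_0}.$$ The structure $\mathcal{J}_0$ coincides with the constant orthogonal complex structure $R_{f'_s(x_0)}\circ L_J\circ R_{f'_s(x_0)^{-1}}$ if, and only if, $(x_0,f'_c(x_0),f'_s(x_0))=0$. It coincides with the constant orthogonal complex structure $L_J$ if, and only if, $f'_s(x_0)\in\mathbb{C}_J$.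
   Context: $\mathbb{O}$ is the real algebra of octonions, identified with $\mathbb{R}^8$ (Euclidean scalar product $\langle x,y\rangle=\mathrm{Re}(xy^c)$), with conjugation $x\mapsto x^c$, $\mathrm{Re}(x)=(x+x^c)/2$, $\mathrm{Im}(x)=x-\mathrm{Re}(x)$; $\mathbb{S}=\{J\in\mathbb{O}: J^2=-1\}$; for $J\in\mathbb{S}$, $\mathbb{C}_J=\mathbb{R}+J\mathbb{R}$ and $\mathbb{C}_J^\perp$ is its orthogonal complement in $\mathbb{O}$. $(x,y,z)=(xy)z-x(yz)$ is the associator. $L_p(x)=px$ and $R_p(x)=xp$. A constant complex structure on $\mathbb{R}^{2n}$ is an $\mathbb{R}$-linear endomorphism with square $-\mathrm{id}$; it is orthogonal if it preserves the Euclidean scalar product. For a nonempty $D\subseteq\mathbb{C}$ invariant under complex conjugation, $\Omega=\Omega_D=\{\alpha+\beta J:\alpha,\beta\in\mathbb{R},\ \alpha+i\beta\in D,\ J\in\mathbb{S}\}$. Let $\mathbb{O}_{\mathbb{C}}=\mathbb{O}\otimes_{\mathbb{R}}\mathbb{C}=\{x+\imath y: x,y\in\mathbb{O}\}$ with $\overline{x+\imath y}=x-\imath y$. A stem function is a map $F=F_1+\imath F_2:D\to\mathbb{O}_{\mathbb{C}}$ with $F(\bar z)=\overline{F(z)}$; it induces the slice function $f=\mathcal{I}(F):\Omega\to\mathbb{O}$, $f(\alpha+\beta J)=F_1(\alpha+i\beta)+JF_2(\alpha+i\beta)$. If $\Omega$ is open, $f$ is slice regular when $F$ is $C^1$ and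 $\frac{\partial F}{\partial\alpha}+\imath\frac{\partial F}{\partial\beta}\equiv0$. The slice derivative is $f'_c=\mathcal{I}(\partial F/\partial z)$ with $\frac{\partial F}{\partial z}=\frac12\left(\frac{\partial F}{\partial\alpha}-\imath\frac{\partial F}{\partial\beta}\right)$; the spherical derivative is $f'_s(x)=\frac12\mathrm{Im}(x)^{-1}(f(x)-f(x^c))$ for $x\in\Omega\setminus\mathbb{R}$. $\mathbb{J}$ is the standard almost-complex structure on $\mathbb{O}\setminus\mathbb{R}$: $\mathbb{J}_{x_0}(v)=\frac{\mathrm{Im}(x_0)}{|\mathrm{Im}(x_0)|}v$ for $x_0\in\mathbb{O}\setminus\mathbb{R}$, $v\in T_{x_0}(\mathbb{O}\setminus\mathbb{R})=\mathbb{O}$. $df_{x_0}$ is the real differential of $f$ at $x_0$.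
   Formalization: The identity J_0∘df_{x_0} = df_{x_0}∘𝕁_{x_0} is claimed only when J = Im(x_0)/|Im(x_0)|; for the opposite choice J = -Im(x_0)/|Im(x_0)| it is false (e.g. f(x)=x). All other claims hold for every J in S with x_0 in Ω_J. *)

theory Defs
  imports "HOL-Analysis.Analysis"
begin

section \<open>The algebra of octonions\<close>

text \<open>
  The octonions arise from the complex numbers by applying twice the Cayley--Dickson doubling
  \<open>(a, b) (c, d) = (a c - d\<^sup>c b, d a + b c\<^sup>c)\<close>,  \<open>(a, b)\<^sup>c = (a\<^sup>c, - b)\<close>.
  The Euclidean structure is the one of the underlying direct sum, so that \<open>octonion\<close>
  is \<open>\<real>\<^sup>8\<close> with its standard scalar product.
\<close>

datatype quaternion = Quaternion (quat_fst: complex) (quat_snd: complex)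

lemma quaternion_eq_iff: "x = y \<longleftrightarrow> quat_fst x = quat_fst y \<and> quat_snd x = quat_snd y"
  by (metis quaternion.collapse)

instantiation quaternion :: ab_group_add
begin

definition "0 = Quaternion 0 0"
definition "x + y = Quaternion (quat_fst x + quat_fst y) (quat_snd x + quat_snd y)"
definition "x - y = Quaternion (quat_fst x - quat_fst y) (quat_snd x - quat_snd y)"
definition "- x = Quaternion (- quat_fst x) (- quat_snd x)"

instance
  by standard (simp_all add: quaternion_eq_iff zero_quaternion_def plus_quaternion_def minus_quaternion_def
      uminus_quaternion_def)

end

lemma quaternion_add_simps [simp]:
  "quat_fst 0 = 0" "quat_snd 0 = 0"
  "quat_fst (x + y) = quat_fst x + quat_fst y" "quat_snd (x + y) = quat_snd x + quat_snd y"
  "quat_fst (x - y) = quat_fst x - quat_fst y" "quat_snd (x - y) = quat_snd x - quat_snd y"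
  "quat_fst (- x) = - quat_fst x" "quat_snd (- x) = - quat_snd x"
  by (simp_all add: zero_quaternion_def plus_quaternion_def minus_quaternion_def uminus_quaternion_def)

instantiation quaternion :: real_vector
begin

definition "r *\<^sub>R x = Quaternion (r *\<^sub>R quat_fst x) (r *\<^sub>R quat_snd x)"

instance
  by standard (simp_all add: quaternion_eq_iff scaleR_quaternion_def scaleR_add_right scaleR_add_left)

end

lemma quaternion_scaleR_simps [simp]:
  "quat_fst (r *\<^sub>R x) = r *\<^sub>R quat_fst x" "quat_snd (r *\<^sub>R x) = r *\<^sub>R quat_snd x"
  by (simp_all add: scaleR_quaternion_def)

instantiation quaternion :: real_inner
begin

definition "x \<bullet> y = quat_fst x \<bullet> quat_fst y + quat_snd x \<bullet> quat_snd y" for x y :: quaternion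
definition "norm x = sqrt (x \<bullet> x)" for x :: quaternion
definition "dist x y = norm (x - y)" for x y :: quaternion
definition "sgn x = x /\<^sub>R norm x" for x :: quaternion
definition "uniformity = (INF e\<in>{0<..}. principal {(x, y :: quaternion). dist x y < e})"
definition "open U \<longleftrightarrow> (\<forall>x\<in>U. eventually (\<lambda>(x', y). x' = x \<longrightarrow> y \<in> U) uniformity)"
  for U :: "quaternion set"

instance
proof
  fix r :: real and x y z :: quaternion
  show "x \<bullet> y = y \<bullet> x" "(x + y) \<bullet> z = x \<bullet> z + y \<bullet> z" "r *\<^sub>R x \<bullet> y = r * (x \<bullet> y)" "0 \<le> x \<bullet> x"
    by (simp_all add: scaleR_quaternion_def inner_quaternion_def inner_commute inner_add_left
        algebra_simps)
  show "x \<bullet> x = 0 \<longleftrightarrow> x = 0"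
    by (simp add: quaternion_eq_iff inner_quaternion_def add_nonneg_eq_0_iff)
qed (rule norm_quaternion_def dist_quaternion_def sgn_quaternion_def uniformity_quaternion_def open_quaternion_def)+

end

instantiation quaternion :: euclidean_space
begin

definition "Basis = (\<lambda>b. Quaternion b 0) ` Basis \<union> (\<lambda>b. Quaternion 0 b) ` Basis"

instance
proof
  fix u v x :: quaternion
  show "(Basis :: quaternion set) \<noteq> {}" "finite (Basis :: quaternion set)"
    by (simp_all add: Basis_quaternion_def)
  show "u \<in> Basis \<Longrightarrow> v \<in> Basis \<Longrightarrow> u \<bullet> v = (if u = v then 1 else 0)"
    by (auto simp: Basis_quaternion_def inner_quaternion_def inner_Basis split: if_splits)
  show "(\<forall>u\<in>Basis. x \<bullet> u = 0) \<longleftrightarrow> x = 0"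
    by (auto simp: Basis_quaternion_def inner_quaternion_def quaternion_eq_iff ball_Un euclidean_all_zero_iff)
qed

end

instantiation quaternion :: real_algebra_1
begin

definition "1 = Quaternion 1 0"
definition "x * y = Quaternion
  (quat_fst x * quat_fst y - cnj (quat_snd y) * quat_snd x)
  (quat_snd y * quat_fst x + quat_snd x * cnj (quat_fst y))"

instance
  by standard
    (simp_all add: quaternion_eq_iff one_quaternion_def times_quaternion_def algebra_simps)

end

definition quat_cnj :: "quaternion \<Rightarrow> quaternion" where
  "quat_cnj x = Quaternion (cnj (quat_fst x)) (- quat_snd x)"

datatype octonion = Octonion (oct_fst: quaternion) (oct_snd: quaternion)

lemma octonion_eq_iff: "x = y \<longleftrightarrow> oct_fst x = oct_fst y \<and> oct_snd x = oct_snd y"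
  by (metis octonion.collapse)

instantiation octonion :: ab_group_add
begin

definition "0 = Octonion 0 0"
definition "x + y = Octonion (oct_fst x + oct_fst y) (oct_snd x + oct_snd y)"
definition "x - y = Octonion (oct_fst x - oct_fst y) (oct_snd x - oct_snd y)"
definition "- x = Octonion (- oct_fst x) (- oct_snd x)"

instance
  by standard (simp_all add: octonion_eq_iff zero_octonion_def plus_octonion_def minus_octonion_def
      uminus_octonion_def)

end

lemma octonion_add_simps [simp]:
  "oct_fst 0 = 0" "oct_snd 0 = 0"
  "oct_fst (x + y) = oct_fst x + oct_fst y" "oct_snd (x + y) = oct_snd x + oct_snd y"
  "oct_fst (x - y) = oct_fst x - oct_fst y" "oct_snd (x - y) = oct_snd x - oct_snd y"
  "oct_fst (- x) = - oct_fst x" "oct_snd (- x) = - oct_snd x"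
  by (simp_all add: zero_octonion_def plus_octonion_def minus_octonion_def uminus_octonion_def)

instantiation octonion :: real_vector
begin

definition "r *\<^sub>R x = Octonion (r *\<^sub>R oct_fst x) (r *\<^sub>R oct_snd x)"

instance
  by standard (simp_all add: octonion_eq_iff scaleR_octonion_def scaleR_add_right scaleR_add_left)

end

lemma octonion_scaleR_simps [simp]:
  "oct_fst (r *\<^sub>R x) = r *\<^sub>R oct_fst x" "oct_snd (r *\<^sub>R x) = r *\<^sub>R oct_snd x"
  by (simp_all add: scaleR_octonion_def)

instantiation octonion :: real_inner
begin

definition "x \<bullet> y = oct_fst x \<bullet> oct_fst y + oct_snd x \<bullet> oct_snd y" for x y :: octonion
definition "norm x = sqrt (x \<bullet> x)" for x :: octonion
definition "dist x y = norm (x - y)" for x y :: octonion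
definition "sgn x = x /\<^sub>R norm x" for x :: octonion
definition "uniformity = (INF e\<in>{0<..}. principal {(x, y :: octonion). dist x y < e})"
definition "open U \<longleftrightarrow> (\<forall>x\<in>U. eventually (\<lambda>(x', y). x' = x \<longrightarrow> y \<in> U) uniformity)"
  for U :: "octonion set"

instance
proof
  fix r :: real and x y z :: octonion
  show "x \<bullet> y = y \<bullet> x" "(x + y) \<bullet> z = x \<bullet> z + y \<bullet> z" "r *\<^sub>R x \<bullet> y = r * (x \<bullet> y)" "0 \<le> x \<bullet> x"
    by (simp_all add: scaleR_octonion_def inner_octonion_def inner_commute inner_add_left
        algebra_simps)
  show "x \<bullet> x = 0 \<longleftrightarrow> x = 0"
    by (simp add: octonion_eq_iff inner_octonion_def add_nonneg_eq_0_iff)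
qed (rule norm_octonion_def dist_octonion_def sgn_octonion_def uniformity_octonion_def open_octonion_def)+

end

instantiation octonion :: euclidean_space
begin

definition "Basis = (\<lambda>b. Octonion b 0) ` Basis \<union> (\<lambda>b. Octonion 0 b) ` Basis"

instance
proof
  fix u v x :: octonion
  show "(Basis :: octonion set) \<noteq> {}" "finite (Basis :: octonion set)"
    by (simp_all add: Basis_octonion_def)
  show "u \<in> Basis \<Longrightarrow> v \<in> Basis \<Longrightarrow> u \<bullet> v = (if u = v then 1 else 0)"
    by (auto simp: Basis_octonion_def inner_octonion_def inner_Basis split: if_splits)
  show "(\<forall>u\<in>Basis. x \<bullet> u = 0) \<longleftrightarrow> x = 0"
    by (auto simp: Basis_octonion_def inner_octonion_def octonion_eq_iff ball_Un euclidean_all_zero_iff)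
qed

end

definition oct_cnj :: "octonion \<Rightarrow> octonion" where
  "oct_cnj x = Octonion (quat_cnj (oct_fst x)) (- oct_snd x)"

instantiation octonion :: "{one, times, inverse}"
begin

definition "1 = Octonion 1 0"
definition "x * y = Octonion
  (oct_fst x * oct_fst y - quat_cnj (oct_snd y) * oct_snd x)
  (oct_snd y * oct_fst x + oct_snd x * quat_cnj (oct_fst y))"
definition "inverse x = oct_cnj x /\<^sub>R (norm x)\<^sup>2" for x :: octonion
definition "x div y = x * inverse y" for x y :: octonion

instance ..

end

text \<open>
  No type class covers nonassociative rings, so \<open>of_real\<close> is not available: the real
  number \<open>r\<close>, regarded as an octonion, is written \<open>r *\<^sub>R 1\<close>.
\<close>

definition oct_reals :: "octonion set" where
  "oct_reals = range (\<lambda>r. r *\<^sub>R 1)"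

definition oct_Re :: "octonion \<Rightarrow> octonion" where
  "oct_Re x = (x + oct_cnj x) /\<^sub>R 2"

definition oct_Im :: "octonion \<Rightarrow> octonion" where
  "oct_Im x = x - oct_Re x"

definition associator :: "octonion \<Rightarrow> octonion \<Rightarrow> octonion \<Rightarrow> octonion" where
  "associator x y z = (x * y) * z - x * (y * z)"

definition Lmul :: "octonion \<Rightarrow> octonion \<Rightarrow> octonion" where
  "Lmul p = (\<lambda>x. p * x)"

definition Rmul :: "octonion \<Rightarrow> octonion \<Rightarrow> octonion" where
  "Rmul p = (\<lambda>x. x * p)"

definition imag_units :: "octonion set" where
  "imag_units = {J. J * J = -1}"

definition slice_plane :: "octonion \<Rightarrow> octonion set" where
  "slice_plane J = {\<alpha> *\<^sub>R 1 + \<beta> *\<^sub>R J | \<alpha> \<beta>. True}"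

lemmas octonion_coord_simps =
  octonion_eq_iff quaternion_eq_iff complex_eq_iff times_octonion_def times_quaternion_def
  one_octonion_def one_quaternion_def oct_cnj_def quat_cnj_def inner_octonion_def
  inner_quaternion_def inner_complex_def

lemma octonion_distrib:
  "(x + y) * z = x * z + y * z" "x * (y + z) = x * y + x * z" for x y z :: octonion
  by (simp_all add: octonion_coord_simps algebra_simps)

lemma octonion_mult_scaleR:
  "(r *\<^sub>R x) * y = r *\<^sub>R (x * y)" "x * (r *\<^sub>R y) = r *\<^sub>R (x * y)" for x y :: octonion
  by (simp_all add: octonion_coord_simps algebra_simps)

lemma octonion_mult_minus:
  "(- x) * y = - (x * y)" "x * (- y) = - (x * y)" for x y :: octonion
  by (simp_all add: octonion_coord_simps)

lemma octonion_mult_diff: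
  "(x - y) * z = x * z - y * z" "x * (y - z) = x * y - x * z" for x y z :: octonion
  by (simp_all add: octonion_coord_simps algebra_simps)

lemma octonion_mult_one: "1 * x = x" "x * 1 = x" for x :: octonion
  by (simp_all add: octonion_coord_simps)

lemma octonion_alternative: "(x * x) * y = x * (x * y)" "(y * x) * x = y * (x * x)"
  for x y :: octonion
  by (simp_all add: octonion_coord_simps algebra_simps)

lemma octonion_inner_eq_Re: "oct_Re (x * oct_cnj y) = (x \<bullet> y) *\<^sub>R 1"
  by (simp add: oct_Re_def octonion_coord_simps algebra_simps)

lemma octonion_mult_cnj: "x * oct_cnj x = (norm x)\<^sup>2 *\<^sub>R 1" "oct_cnj x * x = (norm x)\<^sup>2 *\<^sub>R 1"
  by (simp_all add: power2_norm_eq_inner octonion_coord_simps algebra_simps)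

lemma octonion_inverse: "x * inverse x = 1" "inverse x * x = 1" if "x \<noteq> 0" for x :: octonion
  using that by (simp_all add: inverse_octonion_def octonion_mult_scaleR octonion_mult_cnj)

section \<open>Slice functions\<close>

text \<open>
  The element \<open>x + \<iota> y\<close> of \<open>\<O>\<^sub>\<C> = \<O> \<otimes>\<^sub>\<real> \<C>\<close> is the pair \<open>(x, y)\<close>; only the conjugation
  and the multiplication by \<open>\<iota>\<close> are needed.
\<close>

type_synonym oct_complexified = "octonion \<times> octonion"

definition occ_cnj :: "oct_complexified \<Rightarrow> oct_complexified" where
  "occ_cnj w = (fst w, - snd w)"

definition occ_imult :: "oct_complexified \<Rightarrow> oct_complexified" where
  "occ_imult w = (- snd w, fst w)"

definition circularization :: "complex set \<Rightarrow> octonion set" where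
  "circularization D = {\<alpha> *\<^sub>R 1 + \<beta> *\<^sub>R J | \<alpha> \<beta> J. Complex \<alpha> \<beta> \<in> D \<and> J \<in> imag_units}"

definition stem_function :: "complex set \<Rightarrow> (complex \<Rightarrow> oct_complexified) \<Rightarrow> bool" where
  "stem_function D F \<longleftrightarrow> (\<forall>z\<in>D. F (cnj z) = occ_cnj (F z))"

text \<open>
  A point of \<open>circularization D\<close> has several representations \<open>\<alpha> + \<beta> J\<close>; for a stem
  function all of them give the same value (lemma \<open>slice_function_eq\<close> below).
\<close>

definition slice_function :: "complex set \<Rightarrow> (complex \<Rightarrow> oct_complexified) \<Rightarrow> octonion \<Rightarrow> octonion" where
  "slice_function D F x = (THE y. \<forall>\<alpha> \<beta> J. J \<in> imag_units \<longrightarrow> Complex \<alpha> \<beta> \<in> D \<longrightarrow>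
     x = \<alpha> *\<^sub>R 1 + \<beta> *\<^sub>R J \<longrightarrow> y = fst (F (Complex \<alpha> \<beta>)) + J * snd (F (Complex \<alpha> \<beta>)))"

definition partial_alpha :: "(complex \<Rightarrow> oct_complexified) \<Rightarrow> complex \<Rightarrow> oct_complexified" where
  "partial_alpha F z = vector_derivative (\<lambda>\<alpha>. F (Complex \<alpha> (Im z))) (at (Re z))"

definition partial_beta :: "(complex \<Rightarrow> oct_complexified) \<Rightarrow> complex \<Rightarrow> oct_complexified" where
  "partial_beta F z = vector_derivative (\<lambda>\<beta>. F (Complex (Re z) \<beta>)) (at (Im z))"

definition stem_deriv :: "(complex \<Rightarrow> oct_complexified) \<Rightarrow> complex \<Rightarrow> oct_complexified" where
  "stem_deriv F z = (partial_alpha F z - occ_imult (partial_beta F z)) /\<^sub>R 2"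

definition C1_on :: "complex set \<Rightarrow> (complex \<Rightarrow> oct_complexified) \<Rightarrow> bool" where
  "C1_on D F \<longleftrightarrow> (\<exists>F'. (\<forall>z\<in>D. (F has_derivative blinfun_apply (F' z)) (at z)) \<and>
     continuous_on D F')"

text \<open>
  \<open>slice_regular D F f\<close>: the function \<open>f\<close>, of which only the values on \<open>circularization D\<close>
  matter, is slice regular and is induced by the stem function \<open>F\<close>.
\<close>

definition slice_regular ::
  "complex set \<Rightarrow> (complex \<Rightarrow> oct_complexified) \<Rightarrow> (octonion \<Rightarrow> octonion) \<Rightarrow> bool" where
  "slice_regular D F f \<longleftrightarrow>
     D \<noteq> {} \<and> cnj ` D = D \<and> open (circularization D) \<and>
     stem_function D F \<and> (\<forall>x\<in>circularization D. f x = slice_function D F x) \<and>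
     C1_on D F \<and> (\<forall>z\<in>D. partial_alpha F z + occ_imult (partial_beta F z) = 0)"

definition slice_deriv :: "complex set \<Rightarrow> (complex \<Rightarrow> oct_complexified) \<Rightarrow> octonion \<Rightarrow> octonion" where
  "slice_deriv D F = slice_function D (stem_deriv F)"

definition spherical_deriv :: "(octonion \<Rightarrow> octonion) \<Rightarrow> octonion \<Rightarrow> octonion" where
  "spherical_deriv f x = (inverse (oct_Im x) * (f x - f (oct_cnj x))) /\<^sub>R 2"

lemma imag_unit_props:
  assumes "J \<in> imag_units"
  shows "oct_cnj J = - J" "norm J = 1"
proof -
  define a where "a = J \<bullet> 1"
  have JJ: "J * J = -1"
    using assms by (simp add: imag_units_def)
  have cnj: "oct_cnj J = (2 * a) *\<^sub>R 1 - J"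
    by (simp add: a_def octonion_coord_simps)
  have "(2 * a) *\<^sub>R J = ((norm J)\<^sup>2 - 1) *\<^sub>R 1"
    using octonion_mult_cnj(1)[of J] JJ
    by (simp add: cnj octonion_mult_diff octonion_mult_scaleR octonion_mult_one algebra_simps)
  moreover have False if "J = r *\<^sub>R 1" for r
  proof -
    have "r * r = -1"
      using JJ by (simp add: that octonion_coord_simps)
    then show False
      using zero_le_square[of r] by linarith
  qed
  ultimately have "a = 0"
    by (metis (no_types) mult_eq_0_iff scaleR_scaleR right_inverse scaleR_one
        mult.commute zero_neq_numeral)
  then show "oct_cnj J = - J"
    by (simp add: cnj)
  then have "(norm J)\<^sup>2 *\<^sub>R (1::octonion) = 1"
    using octonion_mult_cnj(1)[of J] JJ by (simp add: octonion_mult_minus)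
  then have "(norm J)\<^sup>2 = 1"
    by (simp add: octonion_coord_simps)
  then show "norm J = 1"
    by (metis norm_ge_zero power2_eq_1_iff norm_not_less_zero less_minus_one_simps(1))
qed

lemma slice_coords_unique:
  assumes "J \<in> imag_units" "K \<in> imag_units" "\<alpha> *\<^sub>R 1 + \<beta> *\<^sub>R J = \<gamma> *\<^sub>R 1 + \<delta> *\<^sub>R K"
  shows "\<alpha> = \<gamma> \<and> (\<beta> = 0 \<and> \<delta> = 0 \<or> \<beta> = \<delta> \<and> J = K \<or> \<delta> = - \<beta> \<and> K = - J)"
proof -
  have J: "J \<bullet> 1 = 0" and K: "K \<bullet> 1 = 0"
    using imag_unit_props(1)[OF assms(1)] imag_unit_props(1)[OF assms(2)]
    by (simp_all add: octonion_coord_simps)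
  have "(\<alpha> *\<^sub>R 1 + \<beta> *\<^sub>R J) \<bullet> 1 = (\<gamma> *\<^sub>R 1 + \<delta> *\<^sub>R K) \<bullet> (1 :: octonion)"
    by (simp add: assms(3))
  then have "\<alpha> = \<gamma>"
    by (simp add: inner_add_left J K) (simp add: octonion_coord_simps)
  then have eq: "\<beta> *\<^sub>R J = \<delta> *\<^sub>R K"
    using assms(3) by simp
  then have "\<bar>\<beta>\<bar> = \<bar>\<delta>\<bar>"
    by (metis norm_scaleR imag_unit_props(2) assms(1,2) mult.right_neutral)
  then consider "\<beta> = 0" "\<delta> = 0" | "\<beta> = \<delta>" "\<delta> \<noteq> 0" | "\<delta> = - \<beta>" "\<beta> \<noteq> 0"
    by linarith
  then show ?thesis
  proof cases
    case 3
    then have "\<beta> *\<^sub>R J = \<beta> *\<^sub>R (- K)"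
      using eq by simp
    then have "J = - K"
      using 3 by (simp only: scaleR_cancel_left) simp
    then show ?thesis
      using 3 \<open>\<alpha> = \<gamma>\<close> by simp
  qed (use eq \<open>\<alpha> = \<gamma>\<close> in auto)
qed

lemma slice_function_eq:
  assumes "stem_function D F" "J \<in> imag_units" "Complex \<alpha> \<beta> \<in> D"
  shows "slice_function D F (\<alpha> *\<^sub>R 1 + \<beta> *\<^sub>R J) = fst (F (Complex \<alpha> \<beta>)) + J * snd (F (Complex \<alpha> \<beta>))"
  unfolding slice_function_def
proof (rule the_equality)
  have F: "F (Complex \<alpha> (- \<beta>)) = occ_cnj (F (Complex \<alpha> \<beta>))"
    using assms(1,3) unfolding stem_function_def by (metis complex_cnj)
  show "\<forall>\<gamma> \<delta> K. K \<in> imag_units \<longrightarrow> Complex \<gamma> \<delta> \<in> D \<longrightarrow>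
    \<alpha> *\<^sub>R 1 + \<beta> *\<^sub>R J = \<gamma> *\<^sub>R 1 + \<delta> *\<^sub>R K \<longrightarrow>
    fst (F (Complex \<alpha> \<beta>)) + J * snd (F (Complex \<alpha> \<beta>)) =
    fst (F (Complex \<gamma> \<delta>)) + K * snd (F (Complex \<gamma> \<delta>))"
  proof (intro allI impI)
    fix \<gamma> \<delta> K
    assume "K \<in> imag_units" and "\<alpha> *\<^sub>R 1 + \<beta> *\<^sub>R J = \<gamma> *\<^sub>R 1 + \<delta> *\<^sub>R K"
    from slice_coords_unique[OF assms(2) this]
    consider "\<gamma> = \<alpha>" "\<beta> = 0" "\<delta> = 0" | "\<gamma> = \<alpha>" "\<delta> = \<beta>" "K = J"
      | "\<gamma> = \<alpha>" "\<delta> = - \<beta>" "K = - J"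
      by auto
    then show "fst (F (Complex \<alpha> \<beta>)) + J * snd (F (Complex \<alpha> \<beta>)) =
      fst (F (Complex \<gamma> \<delta>)) + K * snd (F (Complex \<gamma> \<delta>))"
    proof cases
      case 1
      then have "snd (F (Complex \<alpha> \<beta>)) = - snd (F (Complex \<alpha> \<beta>))"
        using arg_cong[OF F, of snd] by (simp add: occ_cnj_def)
      then have "snd (F (Complex \<alpha> \<beta>)) = 0"
        by (metis (no_types) add_0_right add.right_inverse scaleR_2 scaleR_eq_0_iff zero_neq_numeral)
      then show ?thesis
        using 1 by (simp add: octonion_coord_simps)
    qed (simp_all add: F occ_cnj_def octonion_mult_minus)
  qed
qed (use assms in blast)

section \<open>Complex structures\<close>

definition complex_structure :: "('a::real_vector \<Rightarrow> 'a) \<Rightarrow> bool" where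
  "complex_structure T \<longleftrightarrow> linear T \<and> (\<forall>x. T (T x) = - x)"

definition orthogonal_complex_structure :: "('a::real_inner \<Rightarrow> 'a) \<Rightarrow> bool" where
  "orthogonal_complex_structure T \<longleftrightarrow> complex_structure T \<and> (\<forall>x y. T x \<bullet> T y = x \<bullet> y)"

definition direct_sum_decomposition :: "'a::real_vector set \<Rightarrow> 'a set \<Rightarrow> bool" where
  "direct_sum_decomposition A B \<longleftrightarrow>
     subspace A \<and> subspace B \<and> A \<inter> B = {0} \<and> {p + q | p q. p \<in> A \<and> q \<in> B} = UNIV"

text \<open>
  Caution: for nonreal \<open>x\<close> in \<open>slice_plane J\<close>, \<open>std_almost_complex x\<close> is \<open>Lmul J\<close> or \<open>Lmul (- J)\<close>
  according to the half plane of \<open>slice_plane J\<close> to which \<open>x\<close> belongs.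
\<close>

definition std_almost_complex :: "octonion \<Rightarrow> octonion \<Rightarrow> octonion" where
  "std_almost_complex x v = (oct_Im x /\<^sub>R norm (oct_Im x)) * v"

end

theory Submission
  imports Defs
begin

text \<open>
  Let \<open>P\<close> be the orthogonal projection onto \<open>\<C>\<^sub>J\<close>. Differentiating \<open>f(x) = F\<^sub>1 + (Im x / |Im x|) F\<^sub>2\<close> and using
  the Cauchy--Riemann equations, the differential of \<open>f\<close> at \<open>x\<^sub>0\<close> is \<open>T v = (P v) c + (v - P v) s\<close>, where \<open>c\<close> and \<open>s\<close>
  are the slice and spherical derivatives. The hypothesis \<open>c s\<inverse> \<notin> \<C>\<^sub>J\<^sup>\<bottom>\<close> makes \<open>T\<close> injective, hence
  bijective, which gives the direct sum; and the formula for \<open>\<J>\<^sub>0\<close> says precisely that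
  \<open>\<J>\<^sub>0 = T L\<^sub>J T\<inverse>\<close>. Comparing \<open>T L\<^sub>J\<close> with \<open>S T\<close> for the two orthogonal structures \<open>S\<close> reduces both
  equivalences to the vanishing of associators \<open>(J, c, s)\<close>, resp. \<open>(J, w, s)\<close> for all \<open>w\<close>.
\<close>

section \<open>Octonion arithmetic\<close>

text \<open>Supplies the product rule for differentiating octonion products.\<close>

lemma bounded_bilinear_octonion_mult: "bounded_bilinear ((*) :: octonion \<Rightarrow> octonion \<Rightarrow> octonion)"
  unfolding bilinear_conv_bounded_bilinear[symmetric] bilinear_def
  by (auto intro!: linearI simp: octonion_distrib octonion_mult_scaleR)

lemma octonion_mult_zero [simp]: "0 * x = 0" "x * 0 = 0" for x :: octonion
  using octonion_mult_diff(1)[of 0 0 x] octonion_mult_diff(2)[of x 0 0] by simp_all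

text \<open>Writes conjugation through \<open>1\<close> and \<open>x\<close>, so that laws for
  powers of \<open>x\<close> carry over to \<open>oct_cnj x\<close>.\<close>

lemma oct_cnj_eq: "oct_cnj x = (2 * (x \<bullet> 1)) *\<^sub>R 1 - x"
  by (simp add: octonion_coord_simps)

lemma oct_cnj_cnj [simp]: "oct_cnj (oct_cnj x) = x"
  by (simp add: octonion_coord_simps)

lemma oct_Im_eq: "oct_Im x = x - (x \<bullet> 1) *\<^sub>R 1"
  by (simp add: oct_Im_def oct_Re_def oct_cnj_eq)

lemma inner_one_one [simp]: "(1 :: octonion) \<bullet> 1 = 1"
  by (simp add: octonion_coord_simps)

lemma octonion_inner_mult_left: "(x * y) \<bullet> z = y \<bullet> (oct_cnj x * z)" for x y z :: octonion
  by (simp add: octonion_coord_simps algebra_simps)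

lemma octonion_inner_mult_right: "(x * y) \<bullet> z = x \<bullet> (z * oct_cnj y)" for x y z :: octonion
  by (simp add: octonion_coord_simps algebra_simps)

text \<open>Alternativity and the quadratic equation satisfied by \<open>x\<close> make up for the
  missing associativity.\<close>

lemma oct_cnj_mult_cancel:
  "oct_cnj x * (x * y) = (norm x)\<^sup>2 *\<^sub>R y" "(y * x) * oct_cnj x = (norm x)\<^sup>2 *\<^sub>R y"
  "x * (oct_cnj x * y) = (norm x)\<^sup>2 *\<^sub>R y" "(y * oct_cnj x) * x = (norm x)\<^sup>2 *\<^sub>R y"
proof -
  have "x * x = (2 * (x \<bullet> 1)) *\<^sub>R x - (norm x)\<^sup>2 *\<^sub>R 1"
    using octonion_mult_cnj(1)[of x]
    by (simp add: oct_cnj_eq octonion_mult_diff octonion_mult_scaleR octonion_mult_one algebra_simps)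
  then have "x * (x * y) = (2 * (x \<bullet> 1)) *\<^sub>R (x * y) - (norm x)\<^sup>2 *\<^sub>R y"
    and "(y * x) * x = (2 * (x \<bullet> 1)) *\<^sub>R (y * x) - (norm x)\<^sup>2 *\<^sub>R y"
    by (simp_all add: octonion_alternative[symmetric])
       (simp_all add: octonion_alternative octonion_mult_diff octonion_mult_scaleR octonion_mult_one)
  then show "oct_cnj x * (x * y) = (norm x)\<^sup>2 *\<^sub>R y" "(y * x) * oct_cnj x = (norm x)\<^sup>2 *\<^sub>R y"
    "x * (oct_cnj x * y) = (norm x)\<^sup>2 *\<^sub>R y" "(y * oct_cnj x) * x = (norm x)\<^sup>2 *\<^sub>R y"
    by (simp_all add: oct_cnj_eq octonion_mult_diff octonion_mult_scaleR octonion_mult_one)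
qed

lemma octonion_mult_inverse_cancel:
  fixes s x :: octonion
  assumes "s \<noteq> 0"
  shows "(x * s) * inverse s = x" "(x * inverse s) * s = x"
  using assms by (simp_all add: inverse_octonion_def octonion_mult_scaleR oct_cnj_mult_cancel)

text \<open>Moving one factor across by adjunction lets it cancel. Multiplications are thus
  conformal, which transports orthogonality below.\<close>

lemma octonion_inner_mult_same:
  fixes s x y :: octonion
  shows "(s * x) \<bullet> (s * y) = (norm s)\<^sup>2 * (x \<bullet> y)" "(x * s) \<bullet> (y * s) = (norm s)\<^sup>2 * (x \<bullet> y)"
  by (simp add: octonion_inner_mult_left oct_cnj_mult_cancel)
     (simp add: octonion_inner_mult_right oct_cnj_mult_cancel)

lemma norm_inverse_octonion: "norm (inverse s) = inverse (norm s)" for s :: octonion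
proof -
  have "norm (oct_cnj s) = norm s"
    by (simp add: norm_eq_sqrt_inner octonion_coord_simps)
  then show ?thesis
    by (cases "s = 0") (simp_all add: inverse_octonion_def power2_eq_square)
qed

text \<open>Up to sign, \<open>oct_cnj z\<close> differs from \<open>z\<close> by a real number, and
  reals associate with everything. This lets \<open>s\<close> replace \<open>inverse s\<close> in
  associators.\<close>

lemma associator_cnj: "associator x y (oct_cnj z) = - associator x y z"
  by (simp add: associator_def oct_cnj_eq octonion_mult_diff octonion_mult_scaleR octonion_mult_one)

text \<open>The real part associates with everything; this turns the condition on
  \<open>x\<^sub>0\<close> into one on \<open>J\<close>.\<close>

lemma associator_slice_plane_left:
  "associator (\<alpha> *\<^sub>R 1 + \<beta> *\<^sub>R J) y z = \<beta> *\<^sub>R associator J y z"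
  by (simp add: associator_def octonion_distrib octonion_mult_scaleR octonion_mult_one algebra_simps)

text \<open>
  The map \<open>(x, y) \<mapsto> \<Sum> e\<^sup>c (x, e, y)\<close>, summed over the standard basis, is a nonzero multiple of the
  commutator; so the vanishing of all the associators forces \<open>x\<close> and \<open>y\<close> to commute.
\<close>

lemma commute_if_associator_zero:
  assumes "\<And>w. associator x w y = 0"
  shows "x * y = y * x"
proof -
  let ?e = "\<lambda>a b c d. Octonion (Quaternion a b) (Quaternion c d)"
  let ?S = "\<Sum>e\<leftarrow>[?e 1 0 0 0, ?e \<i> 0 0 0, ?e 0 1 0 0, ?e 0 \<i> 0 0,
      ?e 0 0 1 0, ?e 0 0 \<i> 0, ?e 0 0 0 1, ?e 0 0 0 \<i>]. oct_cnj e * associator x e y"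
  have "?S = 4 *\<^sub>R (x * y - y * x)"
    by (simp add: associator_def octonion_coord_simps algebra_simps)
  then show ?thesis
    by (simp add: assms)
qed

section \<open>The slice through an imaginary unit\<close>

lemma imag_unit_inner:
  assumes "J \<in> imag_units"
  shows "J \<bullet> J = 1" "J \<bullet> 1 = 0" "1 \<bullet> J = 0"
  using imag_unit_props[OF assms] oct_cnj_eq[of J]
  by (auto simp: dot_square_norm inner_commute octonion_coord_simps)

lemma imag_unit_mult_left:
  assumes "J \<in> imag_units"
  shows "J * (J * x) = - x"
  using assms by (simp add: octonion_alternative(1)[symmetric] imag_units_def octonion_mult_minus
      octonion_mult_one)

lemma slice_plane_orthogonal_iff: "w \<in> (slice_plane J)\<^sup>\<bottom> \<longleftrightarrow> w \<bullet> 1 = 0 \<and> w \<bullet> J = 0"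
proof
  assume "w \<in> (slice_plane J)\<^sup>\<bottom>"
  then have "orthogonal w (1 *\<^sub>R 1 + 0 *\<^sub>R J)" "orthogonal w (0 *\<^sub>R 1 + 1 *\<^sub>R J)"
    unfolding orthogonal_comp_def slice_plane_def by (auto simp only: orthogonal_commute)
  then show "w \<bullet> 1 = 0 \<and> w \<bullet> J = 0"
    by (simp add: orthogonal_def)
qed (auto simp: orthogonal_comp_def slice_plane_def orthogonal_def inner_add_right inner_add_left
    inner_commute)

text \<open>
  Image binds more tightly than the orthogonal complement: \<open>(\<lambda>z. z * s) ` (slice_plane J)\<^sup>\<bottom>\<close>, the set
  \<open>B\<close> of the theorem, is parsed as \<open>((\<lambda>z. z * s) ` slice_plane J)\<^sup>\<bottom>\<close>. Since right multiplication is
  conformal, it nevertheless is \<open>\<C>\<^sub>J\<^sup>\<bottom> s\<close>.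
\<close>

lemma orthogonal_comp_mult_right:
  fixes s :: octonion
  assumes "s \<noteq> 0"
  shows "((\<lambda>z. z * s) ` S)\<^sup>\<bottom> = (\<lambda>z. z * s) ` (S\<^sup>\<bottom>)"
proof (rule set_eqI)
  fix x
  define w where "w = x * inverse s"
  have x: "x = w * s"
    by (simp add: w_def octonion_mult_inverse_cancel[OF assms])
  have "x \<in> ((\<lambda>z. z * s) ` S)\<^sup>\<bottom> \<longleftrightarrow> w \<in> S\<^sup>\<bottom>"
    using assms by (simp add: orthogonal_comp_def orthogonal_def x octonion_inner_mult_same)
  also have "\<dots> \<longleftrightarrow> x \<in> (\<lambda>z. z * s) ` (S\<^sup>\<bottom>)"
    using octonion_mult_inverse_cancel(1)[OF assms] x by (metis (no_types, lifting) image_iff w_def)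
  finally show "x \<in> ((\<lambda>z. z * s) ` S)\<^sup>\<bottom> \<longleftrightarrow> x \<in> (\<lambda>z. z * s) ` (S\<^sup>\<bottom>)" .
qed

text \<open>For an imaginary unit \<open>J\<close>, the pair \<open>1\<close>, \<open>J\<close> is
  orthonormal, and this is the projection P onto its span.\<close>

definition slice_proj :: "octonion \<Rightarrow> octonion \<Rightarrow> octonion" where
  "slice_proj J v = (v \<bullet> 1) *\<^sub>R 1 + (v \<bullet> J) *\<^sub>R J"

lemma slice_proj_in: "slice_proj J v \<in> slice_plane J"
  by (auto simp: slice_proj_def slice_plane_def)

lemma linear_slice_proj: "linear (slice_proj J)"
  by (rule linearI) (simp_all add: slice_proj_def inner_add_left algebra_simps)

lemma slice_proj_id: "J \<in> imag_units \<Longrightarrow> z \<in> slice_plane J \<Longrightarrow> slice_proj J z = z"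
  by (auto simp: slice_proj_def slice_plane_def inner_add_left imag_unit_inner)

lemma slice_proj_orthogonal: "w \<in> (slice_plane J)\<^sup>\<bottom> \<Longrightarrow> slice_proj J w = 0"
  by (simp add: slice_plane_orthogonal_iff slice_proj_def)

lemma slice_proj_diff_orthogonal: "J \<in> imag_units \<Longrightarrow> v - slice_proj J v \<in> (slice_plane J)\<^sup>\<bottom>"
  by (simp add: slice_plane_orthogonal_iff slice_proj_def inner_diff_left inner_add_left
      imag_unit_inner)

text \<open>Left multiplication by \<open>J\<close> is skew-adjoint and preserves the plane, so it
  commutes with the projection.\<close>

lemma slice_proj_mult:
  assumes "J \<in> imag_units"
  shows "slice_proj J (J * v) = J * slice_proj J v"
  using assms by (simp add: slice_proj_def octonion_inner_mult_left imag_unit_props(1)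
      octonion_mult_minus octonion_mult_one octonion_distrib octonion_mult_scaleR imag_units_def)

text \<open>Only the plane matters, not its orientation; needed when \<open>x\<^sub>0\<close> lies
  in the lower half plane of \<open>J\<close>.\<close>

lemma slice_proj_minus: "slice_proj (- J) = slice_proj J"
  by (simp add: slice_proj_def fun_eq_iff)

text \<open>By bilinearity only the case \<open>z = u = J\<close> needs an argument, and it is
  alternativity.\<close>

lemma slice_plane_mult_left:
  assumes "J \<in> imag_units" "z \<in> slice_plane J" "u \<in> slice_plane J"
  shows "z * (u * x) = (z * u) * x"
  using assms by (auto simp: slice_plane_def octonion_distrib octonion_mult_scaleR
      octonion_mult_one octonion_alternative(1) algebra_simps)

lemma imag_unit_in_slice_plane: "J \<in> slice_plane J"
  unfolding slice_plane_def by (rule CollectI) (rule exI[of _ 0], rule exI[of _ 1], simp)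

lemma slice_plane_closed_mult:
  assumes "J \<in> imag_units" "z \<in> slice_plane J" "u \<in> slice_plane J"
  shows "z * u \<in> slice_plane J"
proof -
  obtain a b a' b' where "z = a *\<^sub>R 1 + b *\<^sub>R J" "u = a' *\<^sub>R 1 + b' *\<^sub>R J"
    using assms by (auto simp: slice_plane_def)
  then have "z * u = (a * a' - b * b') *\<^sub>R 1 + (a * b' + b * a') *\<^sub>R J"
    using assms(1) by (simp add: imag_units_def octonion_distrib octonion_mult_scaleR
        octonion_mult_one algebra_simps)
  then show ?thesis
    by (auto simp: slice_plane_def)
qed

text \<open>The component of \<open>s\<close> orthogonal to the plane anticommutes with
  \<open>J\<close>; if it also commutes with \<open>J\<close>, it vanishes.\<close>

lemma slice_plane_if_commute:
  assumes J: "J \<in> imag_units" and "J * s = s * J"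
  shows "s \<in> slice_plane J"
proof -
  define u where "u = s - slice_proj J s"
  have u: "u \<bullet> 1 = 0" "u \<bullet> J = 0"
    using slice_proj_diff_orthogonal[OF J, of s] by (simp_all add: slice_plane_orthogonal_iff u_def)
  \<comment> \<open>Polarization of the quadratic equation of an octonion.\<close>
  have "J * u + u * J = (2 * (J \<bullet> 1)) *\<^sub>R u + (2 * (u \<bullet> 1)) *\<^sub>R J - (2 * (u \<bullet> J)) *\<^sub>R 1"
    by (simp add: octonion_coord_simps algebra_simps)
  then have "J * u + u * J = 0"
    by (simp add: u imag_unit_inner[OF J])
  moreover have "J * u = u * J"
    using assms(2) by (simp add: u_def slice_proj_def octonion_mult_diff octonion_distrib
        octonion_mult_scaleR octonion_mult_one)
  ultimately have "2 *\<^sub>R (J * u) = 0"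
    by (simp add: scaleR_2)
  then have "J * u = 0"
    by simp
  then have "u = 0"
    using imag_unit_mult_left[OF J, of u] by simp
  then show ?thesis
    using slice_proj_in[of J s] by (simp add: u_def)
qed

section \<open>The two orthogonal complex structures\<close>

lemma orthogonal_complex_structure_Lmul:
  "J \<in> imag_units \<Longrightarrow> orthogonal_complex_structure (Lmul J)"
  by (auto simp: orthogonal_complex_structure_def complex_structure_def Lmul_def
      imag_unit_mult_left octonion_inner_mult_same imag_unit_props octonion_distrib
      octonion_mult_scaleR intro!: linearI)

text \<open>The outer factors scale norms by reciprocal amounts, so conjugating preserves
  orthogonality.\<close>

lemma orthogonal_complex_structure_conj:
  assumes "J \<in> imag_units" "s \<noteq> 0"
  shows "orthogonal_complex_structure (Rmul s \<circ> Lmul J \<circ> Rmul (inverse s))"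
  using assms by (auto simp: orthogonal_complex_structure_def complex_structure_def Lmul_def
      Rmul_def imag_unit_mult_left octonion_inner_mult_same imag_unit_props octonion_distrib
      octonion_mult_scaleR octonion_mult_inverse_cancel norm_inverse_octonion octonion_mult_minus
      power_inverse intro!: linearI)

section \<open>The intertwining operator\<close>

definition slice_op :: "octonion \<Rightarrow> octonion \<Rightarrow> octonion \<Rightarrow> octonion \<Rightarrow> octonion" where
  "slice_op J c s v = slice_proj J v * c + (v - slice_proj J v) * s"

lemma linear_slice_op: "linear (slice_op J c s)"
  by (rule linearI) (simp_all add: slice_op_def linear_add[OF linear_slice_proj]
      linear_scale[OF linear_slice_proj] octonion_distrib octonion_mult_diff octonion_mult_scaleR
      algebra_simps)

lemma slice_op_add:
  assumes "J \<in> imag_units" "z \<in> slice_plane J" "w \<in> (slice_plane J)\<^sup>\<bottom>"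
  shows "slice_op J c s (z + w) = z * c + w * s"
  using assms by (simp add: slice_op_def linear_add[OF linear_slice_proj] slice_proj_id
      slice_proj_orthogonal)

text \<open>\<open>J\<close> can be pulled out of the first summand, where it associates, but in
  general not out of the second.\<close>

lemma slice_op_mult:
  assumes "J \<in> imag_units"
  shows "slice_op J c s (J * v) = J * (slice_proj J v * c) + (J * (v - slice_proj J v)) * s"
  using slice_plane_mult_left[OF assms imag_unit_in_slice_plane slice_proj_in]
  by (simp add: slice_op_def slice_proj_mult[OF assms] octonion_mult_diff)

text \<open>A kernel element whose component \<open>z\<close> in the plane is nonzero would make
  \<open>z * c\<close>, hence \<open>c\<close>, orthogonal to the plane times \<open>s\<close>,
  against the hypothesis on \<open>c * inverse s\<close>.\<close>

lemma bij_slice_op: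
  assumes J: "J \<in> imag_units" and s: "s \<noteq> 0" and cs: "c * inverse s \<notin> (slice_plane J)\<^sup>\<bottom>"
  shows "bij (slice_op J c s)"
proof -
  have "v = 0" if "slice_op J c s v = 0" for v
  proof -
    define z where "z = slice_proj J v"
    define w where "w = v - slice_proj J v"
    have z: "z \<in> slice_plane J" and w: "w \<in> (slice_plane J)\<^sup>\<bottom>" and eq: "z * c + w * s = 0"
      using that J by (simp_all add: z_def w_def slice_proj_in slice_proj_diff_orthogonal slice_op_def)
    have "z = 0"
    proof (rule ccontr)
      assume "z \<noteq> 0"
      have "(c * inverse s) \<bullet> u = 0" if u: "u \<in> slice_plane J" for u
      proof -
        have "w \<bullet> (z * u) = 0"
          using w slice_plane_closed_mult[OF J z u]
          by (simp add: orthogonal_comp_def orthogonal_def inner_commute[of w])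
        \<comment> \<open>Pairing the equation with \<open>(z * u) * s\<close> kills the
          \<open>w\<close> term, since right multiplication by \<open>s\<close> is
          conformal.\<close>
        then have "(z * c) \<bullet> ((z * u) * s) = 0"
          using arg_cong[OF eq, of "\<lambda>x. x \<bullet> ((z * u) * s)"]
          by (simp add: inner_add_left octonion_inner_mult_same)
        \<comment> \<open>Reassociating to \<open>z * (u * s)\<close> allows \<open>z\<close> to be
          cancelled by conformality on the left.\<close>
        then have "c \<bullet> (u * s) = 0"
          using \<open>z \<noteq> 0\<close> by (simp add: slice_plane_mult_left[OF J z u, symmetric]
              octonion_inner_mult_same)
        then show ?thesis
          by (simp add: inverse_octonion_def octonion_mult_scaleR octonion_inner_mult_right inner_commute[of u])
      qed
      then have "c * inverse s \<in> (slice_plane J)\<^sup>\<bottom>"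
        by (simp add: orthogonal_comp_def orthogonal_def inner_commute)
      then show False
        using cs by contradiction
    qed
    moreover have "w = 0"
      using octonion_mult_inverse_cancel(1)[OF s, of w] eq \<open>z = 0\<close> by simp
    ultimately show "v = 0"
      by (simp add: z_def w_def)
  qed
  then have "inj (slice_op J c s)"
    using linear_injective_0[OF linear_slice_op] by blast
  then show ?thesis
    using linear_injective_imp_surjective[OF linear_slice_op] by (simp add: bij_def)
qed

text \<open>The two summands are the images of the plane and its complement under the bijection
  \<open>slice_op J c s\<close>.\<close>

lemma direct_sum_slice:
  assumes J: "J \<in> imag_units" and s: "s \<noteq> 0" and cs: "c * inverse s \<notin> (slice_plane J)\<^sup>\<bottom>"
  shows "direct_sum_decomposition ((\<lambda>z. z * c) ` slice_plane J) ((\<lambda>z. z * s) ` ((slice_plane J)\<^sup>\<bottom>))"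
    (is "direct_sum_decomposition ?A ?B")
proof -
  have "slice_plane J = range (slice_proj J)"
    using slice_proj_id[OF J] slice_proj_in[of J] by (metis image_iff subset_antisym subsetI UNIV_I)
  then have "subspace (slice_plane J)"
    using linear_subspace_image[OF linear_slice_proj subspace_UNIV] by simp
  moreover have lin: "linear (\<lambda>z. z * x)" for x :: octonion
    by (rule linearI) (simp_all add: octonion_distrib octonion_mult_scaleR)
  ultimately have sub: "subspace ?A" "subspace ?B"
    by (auto intro!: linear_subspace_image subspace_orthogonal_comp)
  have inj: "inj (slice_op J c s)" and surj: "surj (slice_op J c s)"
    using bij_slice_op[OF assms] by (simp_all add: bij_def)
  have "x = 0" if x: "x \<in> ?A" "x \<in> ?B" for x
  proof -
    from x(1) obtain z where z: "x = z * c" "z \<in> slice_plane J"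
      by (rule imageE)
    from x(2) obtain w where w: "x = w * s" "w \<in> (slice_plane J)\<^sup>\<bottom>"
      by (rule imageE)
    have 0: "0 \<in> slice_plane J" "0 \<in> (slice_plane J)\<^sup>\<bottom>"
      using \<open>subspace (slice_plane J)\<close> subspace_orthogonal_comp by (auto intro: subspace_0)
    have "slice_op J c s (z + 0) = slice_op J c s (0 + w)"
      unfolding slice_op_add[OF J z(2) 0(2)] slice_op_add[OF J 0(1) w(2)] using z w by simp
    then have "z = w"
      using inj by (simp add: inj_eq)
    then have "z \<bullet> z = 0"
      using z w by (auto simp: orthogonal_comp_def orthogonal_def)
    then show "x = 0"
      using z by simp
  qed
  then have "?A \<inter> ?B = {0}"
    using sub subspace_0 by blast
  moreover have "{p + q | p q. p \<in> ?A \<and> q \<in> ?B} = UNIV"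
  proof -
    have "\<exists>p q. x = p + q \<and> p \<in> ?A \<and> q \<in> ?B" for x
    proof -
      obtain v where "x = slice_op J c s v"
        using surj by (metis surjD)
      then show ?thesis
        unfolding slice_op_def
        by (intro exI conjI, assumption)
           (intro imageI slice_proj_in slice_proj_diff_orthogonal J)+
    qed
    then show ?thesis
      by blast
  qed
  ultimately show ?thesis
    using sub by (simp add: direct_sum_decomposition_def)
qed

text \<open>A pair \<open>p = z * c\<close>, \<open>q = w * s\<close> is the value of
  \<open>slice_op J c s\<close> at \<open>z + w\<close>, split into its two terms;
  \<open>q * inverse s\<close> recovers \<open>w\<close>.\<close>

lemma slice_structure_iff_intertwines:
  assumes J: "J \<in> imag_units" and s: "s \<noteq> 0"
  shows "(\<forall>p\<in>(\<lambda>z. z * c) ` slice_plane J. \<forall>q\<in>(\<lambda>z. z * s) ` ((slice_plane J)\<^sup>\<bottom>).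
      \<J> (p + q) = J * p + (J * (q * inverse s)) * s) \<longleftrightarrow>
    (\<forall>v. \<J> (slice_op J c s v) = slice_op J c s (J * v))" (is "?lhs \<longleftrightarrow> ?rhs")
proof
  assume ?lhs
  show ?rhs
  proof
    fix v
    have "\<J> (slice_proj J v * c + (v - slice_proj J v) * s) =
        J * (slice_proj J v * c) + (J * (((v - slice_proj J v) * s) * inverse s)) * s"
      using \<open>?lhs\<close>[rule_format, OF imageI[OF slice_proj_in] imageI[OF slice_proj_diff_orthogonal[OF J]]] .
    then show "\<J> (slice_op J c s v) = slice_op J c s (J * v)"
      by (simp add: slice_op_mult[OF J] octonion_mult_inverse_cancel[OF s])
         (simp add: slice_op_def)
  qed
next
  assume rhs: ?rhs
  have "\<J> (z * c + w * s) = J * (z * c) + (J * ((w * s) * inverse s)) * s"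
    if z: "z \<in> slice_plane J" and w: "w \<in> (slice_plane J)\<^sup>\<bottom>" for z w
  proof -
    have "slice_proj J (z + w) = z"
      using z w J by (simp add: linear_add[OF linear_slice_proj] slice_proj_id slice_proj_orthogonal)
    then show ?thesis
      using rhs[rule_format, of "z + w"]
      by (simp add: slice_op_add[OF J z w] slice_op_mult[OF J] octonion_mult_inverse_cancel[OF s])
  qed
  then show ?lhs
    by blast
qed

text \<open>Here \<open>\<J>\<close> is the conjugate of left multiplication by \<open>J\<close>
  under the linear bijection \<open>T\<close>.\<close>

lemma complex_structure_if_intertwines:
  fixes T :: "octonion \<Rightarrow> octonion"
  assumes "bij T" "linear T" "J \<in> imag_units" "\<And>v. \<J> (T v) = T (J * v)"
  shows "complex_structure \<J>"
proof -
  have \<J>: "\<J> x = T (J * inv T x)" for x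
    using assms(4)[of "inv T x"] assms(1) by (simp add: bij_is_surj surj_f_inv_f)
  have inv: "linear (inv T)"
    using assms(1,2) by (simp add: bij_is_inj inj_linear_imp_inv_linear)
  show ?thesis
    unfolding complex_structure_def
  proof (intro conjI allI linearI)
    fix x y :: octonion and r :: real
    show "\<J> (x + y) = \<J> x + \<J> y" "\<J> (r *\<^sub>R x) = r *\<^sub>R \<J> x"
      by (simp_all add: \<J> linear_add[OF inv] linear_scale[OF inv] linear_add[OF assms(2)]
          linear_scale[OF assms(2)] octonion_distrib octonion_mult_scaleR)
    show "\<J> (\<J> x) = - x"
      using assms(1) by (simp add: \<J>[of x] assms(4) imag_unit_mult_left[OF assms(3)]
          linear_neg[OF assms(2)] bij_is_surj surj_f_inv_f)
  qed
qed

section \<open>Coincidence with the two orthogonal structures\<close>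

text \<open>Both sides agree on the complement of the plane by cancelling \<open>s\<close>. On the
  plane the obstruction is the associator of \<open>J\<close>, \<open>z * c\<close>,
  \<open>s\<close>, and it suffices to test \<open>z = 1\<close>.\<close>

lemma intertwines_conj_iff:
  assumes J: "J \<in> imag_units" and s: "s \<noteq> 0"
  shows "(\<forall>v. (Rmul s \<circ> Lmul J \<circ> Rmul (inverse s)) (slice_op J c s v) = slice_op J c s (J * v))
    \<longleftrightarrow> associator J c s = 0"
proof -
  have conj: "(J * (y * inverse s)) * s = J * y \<longleftrightarrow> associator J y s = 0" for y
  proof -
    have "(J * (y * inverse s)) * s = J * y \<longleftrightarrow> J * (y * inverse s) = (J * y) * inverse s"
      by (metis octonion_mult_inverse_cancel[OF s])
    also have "\<dots> \<longleftrightarrow> associator J y (oct_cnj s) = 0"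
      using s by (auto simp: inverse_octonion_def octonion_mult_scaleR associator_def)
    finally show ?thesis
      by (simp add: associator_cnj)
  qed
  have "(Rmul s \<circ> Lmul J \<circ> Rmul (inverse s)) (slice_op J c s v) = slice_op J c s (J * v) \<longleftrightarrow>
      associator J (slice_proj J v * c) s = 0" for v
    by (simp add: slice_op_mult[OF J] conj[symmetric])
       (simp add: slice_op_def Rmul_def Lmul_def octonion_distrib octonion_mult_inverse_cancel[OF s])
  \<comment> \<open>By linearity only \<open>z = J\<close> remains; there both products reduce to
    \<open>- (c * s)\<close>.\<close>
  moreover have "associator J (z * c) s = 0" if "z \<in> slice_plane J" "associator J c s = 0" for z
  proof -
    have "(J * c) * s = J * (c * s)"
      using that by (simp add: associator_def)
    then show ?thesis
      using that imag_unit_mult_left[OF J] by (auto simp: slice_plane_def associator_def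
          octonion_distrib octonion_mult_diff octonion_mult_scaleR octonion_mult_one octonion_mult_minus)
  qed
  moreover have "slice_proj J 1 * c = c"
    by (simp add: slice_proj_def imag_unit_inner[OF J] octonion_mult_one)
  ultimately show ?thesis
    using slice_proj_in by metis
qed

text \<open>The defect is the associator of \<open>J\<close>, \<open>w\<close>, \<open>s\<close>
  with \<open>w\<close> orthogonal to the plane. It vanishes anyway for \<open>w\<close> in the
  plane, so intertwining gives it for all \<open>w\<close>, and \<open>J\<close> commutes with
  \<open>s\<close>.\<close>

lemma intertwines_Lmul_iff:
  assumes J: "J \<in> imag_units"
  shows "(\<forall>v. Lmul J (slice_op J c s v) = slice_op J c s (J * v)) \<longleftrightarrow> s \<in> slice_plane J"
proof -
  have eq: "Lmul J (slice_op J c s v) = slice_op J c s (J * v) \<longleftrightarrow>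
      associator J (v - slice_proj J v) s = 0" for v
    by (simp add: slice_op_mult[OF J]) (auto simp: slice_op_def Lmul_def octonion_distrib associator_def)
  show ?thesis
  proof
    assume L: "\<forall>v. Lmul J (slice_op J c s v) = slice_op J c s (J * v)"
    have "associator J w s = 0" for w
    proof -
      have "associator J (slice_proj J w) s = 0"
        using slice_plane_mult_left[OF J imag_unit_in_slice_plane slice_proj_in]
        by (simp add: associator_def)
      moreover have "associator J (w - slice_proj J w) s = 0"
        using L eq by blast
      ultimately show ?thesis
        by (simp add: associator_def octonion_mult_diff)
    qed
    then show "s \<in> slice_plane J"
      using slice_plane_if_commute[OF J] commute_if_associator_zero by blast
  next
    assume "s \<in> slice_plane J"
    \<comment> \<open>The flexible law settles the \<open>J\<close> component of \<open>s\<close>;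
      the real component associates.\<close>
    moreover have "(J * w) * J = J * (w * J)" for w
      by (simp add: octonion_coord_simps algebra_simps)
    ultimately have "associator J w s = 0" for w
      by (auto simp: slice_plane_def associator_def octonion_distrib octonion_mult_scaleR
          octonion_mult_one)
    then show "\<forall>v. Lmul J (slice_op J c s v) = slice_op J c s (J * v)"
      by (simp add: eq)
  qed
qed

section \<open>The differential of a slice regular function\<close>

lemma normalized_Im_in_imag_units:
  assumes "oct_Im x \<noteq> 0"
  shows "oct_Im x /\<^sub>R norm (oct_Im x) \<in> imag_units"
proof -
  define K where "K = oct_Im x /\<^sub>R norm (oct_Im x)"
  have "K \<bullet> 1 = 0" "norm K = 1"
    using assms by (simp add: K_def, simp add: oct_Im_eq inner_diff_left) (simp add: K_def assms)
  then have "- (K * K) = 1"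
    using octonion_mult_cnj(1)[of K] by (simp add: oct_cnj_eq octonion_mult_minus)
  then have "K * K = -1"
    using minus_minus[of "K * K"] by simp
  then show ?thesis
    unfolding K_def[symmetric] imag_units_def by simp
qed

lemma oct_Im_slice:
  assumes "J \<in> imag_units"
  shows "oct_Im (\<alpha> *\<^sub>R 1 + \<beta> *\<^sub>R J) = \<beta> *\<^sub>R J" "(\<alpha> *\<^sub>R 1 + \<beta> *\<^sub>R J) \<bullet> 1 = \<alpha>"
  using assms by (simp_all add: oct_Im_eq inner_add_left imag_unit_inner)

lemma minus_imag_units: "J \<in> imag_units \<Longrightarrow> - J \<in> imag_units"
  by (simp add: imag_units_def octonion_mult_minus)

text \<open>Symmetry of \<open>D\<close> allows the representation with nonnegative imaginary
  coordinate, which is a function of the point.\<close>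

lemma circularization_coords:
  assumes "cnj ` D = D" "x \<in> circularization D"
  shows "Complex (x \<bullet> 1) (norm (oct_Im x)) \<in> D"
proof -
  obtain \<alpha> \<beta> J where x: "x = \<alpha> *\<^sub>R 1 + \<beta> *\<^sub>R J" "Complex \<alpha> \<beta> \<in> D" "J \<in> imag_units"
    using assms(2) by (auto simp: circularization_def)
  have "Complex \<alpha> (- \<beta>) \<in> D"
    using assms(1) x(2) by (metis complex_cnj imageI)
  with x(2) have "Complex \<alpha> \<bar>\<beta>\<bar> \<in> D"
    by (simp add: abs_if)
  then show ?thesis
    by (simp add: x(1) oct_Im_slice[OF x(3)] imag_unit_props[OF x(3)])
qed

text \<open>\<open>D\<close> is the preimage of its circularization under the embedding of the
  complex plane given by one fixed imaginary unit.\<close>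

lemma open_circularization_imp_open:
  assumes "cnj ` D = D" "open (circularization D)"
  shows "open D"
proof -
  define J where "J = Octonion (Quaternion \<i> 0) 0"
  have J: "J \<in> imag_units"
    by (simp add: imag_units_def J_def octonion_coord_simps)
  define h where "h z = Re z *\<^sub>R 1 + Im z *\<^sub>R J" for z
  have "z \<in> D" if "h z \<in> circularization D" for z
  proof -
    \<comment> \<open>The canonical coordinates lose the sign of \<open>Im z\<close>; the symmetry
      of \<open>D\<close> restores it.\<close>
    have "Complex (Re z) \<bar>Im z\<bar> \<in> D"
      using circularization_coords[OF assms(1) that]
      by (simp add: h_def oct_Im_slice[OF J] imag_unit_props[OF J])
    moreover from this have "Complex (Re z) (- \<bar>Im z\<bar>) \<in> D"
      using assms(1) by (metis complex_cnj imageI)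
    ultimately show "z \<in> D"
      by (cases "Im z \<ge> 0") simp_all
  qed
  moreover have "h z \<in> circularization D" if "z \<in> D" for z
    using that J complex_surj[of z] unfolding circularization_def h_def by force
  ultimately have "D = h -` circularization D"
    by auto
  moreover have "continuous_on UNIV h"
    unfolding h_def by (intro continuous_intros)
  ultimately show ?thesis
    using assms(2) by (metis open_vimage)
qed

section \<open>Derivatives of stem functions\<close>

lemma partial_eq_derivative:
  assumes F: "(F has_derivative F') (at z)"
  shows "partial_alpha F z = F' 1" "partial_beta F z = F' \<i>"
proof -
  have lin: "linear F'"
    using F by (rule has_derivative_linear)
  have Fz: "(F has_derivative F') (at (Complex (Re z) (Im z)))"
    using F by simp
  have "((\<lambda>\<alpha>. Complex \<alpha> (Im z)) has_derivative (\<lambda>h. h *\<^sub>R 1)) (at (Re z))"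
    unfolding Complex_eq by (auto intro!: derivative_eq_intros simp: scaleR_conv_of_real)
  from diff_chain_at[OF this Fz]
  show "partial_alpha F z = F' 1"
    unfolding partial_alpha_def
    by (intro vector_derivative_at)
       (simp add: has_vector_derivative_def o_def linear_scale[OF lin])
  have "((\<lambda>\<beta>. Complex (Re z) \<beta>) has_derivative (\<lambda>h. h *\<^sub>R \<i>)) (at (Im z))"
    unfolding Complex_eq by (auto intro!: derivative_eq_intros simp: scaleR_conv_of_real)
  from diff_chain_at[OF this Fz]
  show "partial_beta F z = F' \<i>"
    unfolding partial_beta_def
    by (intro vector_derivative_at)
       (simp add: has_vector_derivative_def o_def linear_scale[OF lin])
qed

text \<open>Differentiate the stem condition on the open set \<open>D\<close> in two ways and
  compare.\<close>

lemma stem_derivative_cnj: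
  assumes "open D" "stem_function D F" "z \<in> D"
    and F: "(F has_derivative F') (at z)" and G: "(F has_derivative G') (at (cnj z))"
  shows "G' (cnj h) = occ_cnj (F' h)"
proof -
  have "bounded_linear occ_cnj"
    unfolding linear_conv_bounded_linear[symmetric] by (rule linearI) (simp_all add: occ_cnj_def)
  then have "((\<lambda>w. occ_cnj (F w)) has_derivative (\<lambda>h. occ_cnj (F' h))) (at z)"
    using F by (rule bounded_linear.has_derivative)
  then have "((\<lambda>w. F (cnj w)) has_derivative (\<lambda>h. occ_cnj (F' h))) (at z)"
    using assms(1-3) by (elim has_derivative_transform_within_open) (auto simp: stem_function_def)
  moreover have "((\<lambda>w. F (cnj w)) has_derivative (\<lambda>h. G' (cnj h))) (at z)"
    using diff_chain_at[OF bounded_linear_imp_has_derivative[OF bounded_linear_cnj] G]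
    by (simp add: o_def)
  ultimately show ?thesis
    using has_derivative_unique by metis
qed

text \<open>Ensures that the slice derivative is well defined, so that
  \<open>slice_function_eq\<close> evaluates it.\<close>

lemma stem_function_stem_deriv:
  assumes "slice_regular D F f"
  shows "stem_function D (stem_deriv F)"
  unfolding stem_function_def
proof
  fix z assume z: "z \<in> D"
  have D: "open D" "cnj z \<in> D" "stem_function D F"
    using assms open_circularization_imp_open z by (auto simp: slice_regular_def)
  obtain F' where F': "\<And>z. z \<in> D \<Longrightarrow> (F has_derivative blinfun_apply (F' z)) (at z)"
    using assms unfolding slice_regular_def C1_on_def by metis
  have "blinfun_apply (F' (cnj z)) (cnj h) = occ_cnj (blinfun_apply (F' z) h)" for h
    using stem_derivative_cnj[OF D(1,3) z F'[OF z] F'[OF D(2)]] .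
  \<comment> \<open>The directions whose conjugates are \<open>1\<close> and
    \<open>\<i>\<close>.\<close>
  from this[of 1] this[of "- \<i>"]
  have "blinfun_apply (F' (cnj z)) 1 = occ_cnj (blinfun_apply (F' z) 1)"
    and "blinfun_apply (F' (cnj z)) \<i> = - occ_cnj (blinfun_apply (F' z) \<i>)"
    by (simp_all add: blinfun.minus_right occ_cnj_def)
  then show "stem_deriv F (cnj z) = occ_cnj (stem_deriv F z)"
    by (simp add: stem_deriv_def partial_eq_derivative[OF F'[OF z]]
        partial_eq_derivative[OF F'[OF D(2)]] occ_cnj_def occ_imult_def prod_eq_iff algebra_simps)
qed

lemma slice_regular_eq:
  assumes "slice_regular D F f" "J \<in> imag_units" "Complex \<alpha> \<beta> \<in> D"
  shows "f (\<alpha> *\<^sub>R 1 + \<beta> *\<^sub>R J) = fst (F (Complex \<alpha> \<beta>)) + J * snd (F (Complex \<alpha> \<beta>))"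
proof -
  have "\<alpha> *\<^sub>R 1 + \<beta> *\<^sub>R J \<in> circularization D"
    using assms(2,3) by (auto simp: circularization_def)
  then show ?thesis
    using assms slice_function_eq[OF _ assms(2,3)] by (simp add: slice_regular_def)
qed

text \<open>Conjugating the point replaces \<open>J\<close> by \<open>- J\<close>, so the difference
  leaves twice the \<open>J\<close> term; the inverse of the imaginary part then cancels
  \<open>J\<close>.\<close>

lemma spherical_deriv_eq:
  assumes "slice_regular D F f" "J \<in> imag_units" "Complex \<alpha> \<beta> \<in> D" "\<beta> \<noteq> 0"
  shows "spherical_deriv f (\<alpha> *\<^sub>R 1 + \<beta> *\<^sub>R J) = snd (F (Complex \<alpha> \<beta>)) /\<^sub>R \<beta>"
proof -
  have "oct_cnj (\<alpha> *\<^sub>R 1 + \<beta> *\<^sub>R J) = \<alpha> *\<^sub>R 1 + \<beta> *\<^sub>R (- J)"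
    unfolding oct_cnj_eq oct_Im_slice(2)[OF assms(2)]
    by (simp add: scaleR_scaleR[symmetric] scaleR_2 del: scaleR_scaleR)
  then have "f (oct_cnj (\<alpha> *\<^sub>R 1 + \<beta> *\<^sub>R J)) = fst (F (Complex \<alpha> \<beta>)) - J * snd (F (Complex \<alpha> \<beta>))"
    using slice_regular_eq[OF assms(1) minus_imag_units[OF assms(2)] assms(3)]
    by (simp only: octonion_mult_minus add_uminus_conv_diff)
  then have "f (\<alpha> *\<^sub>R 1 + \<beta> *\<^sub>R J) - f (oct_cnj (\<alpha> *\<^sub>R 1 + \<beta> *\<^sub>R J)) =
      2 *\<^sub>R (J * snd (F (Complex \<alpha> \<beta>)))"
    by (simp add: slice_regular_eq[OF assms(1-3)] scaleR_2)
  moreover have "inverse (\<beta> *\<^sub>R J) = - (J /\<^sub>R \<beta>)"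
    using assms(4) by (simp add: inverse_octonion_def oct_cnj_eq imag_unit_inner[OF assms(2)]
        imag_unit_props[OF assms(2)] power2_eq_square)
  ultimately show ?thesis
    by (simp add: spherical_deriv_def oct_Im_slice[OF assms(2)] octonion_mult_minus
        octonion_mult_scaleR imag_unit_mult_left[OF assms(2)])
qed

text \<open>
  The Cauchy--Riemann equations make the differential right multiplication by the slice derivative
  along the slice; across the slice only the direction \<open>Im x / |Im x|\<close> varies, which contributes
  right multiplication by the spherical derivative.
\<close>

lemma slice_regular_has_derivative:
  assumes f: "slice_regular D F f" and K: "K \<in> imag_units" and D: "Complex \<alpha> \<beta> \<in> D" and \<beta>: "\<beta> > 0"
    and x: "x = \<alpha> *\<^sub>R 1 + \<beta> *\<^sub>R K"
  shows "(f has_derivative slice_op K (slice_deriv D F x) (spherical_deriv f x)) (at x)"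
proof -
  let ?z = "Complex \<alpha> \<beta>"
  obtain F' where F': "(F has_derivative blinfun_apply F') (at ?z)"
    using f D unfolding slice_regular_def C1_on_def by metis
  define a1 a2 b where "a1 = fst (blinfun_apply F' 1)" and "a2 = snd (blinfun_apply F' 1)"
    and "b = snd (F ?z)"
  have A: "partial_alpha F ?z = (a1, a2)"
    by (simp add: partial_eq_derivative[OF F'] a1_def a2_def)
  have CR: "partial_alpha F ?z + occ_imult (partial_beta F ?z) = 0"
    using f D by (simp add: slice_regular_def)
  \<comment> \<open>The beta derivative is \<iota> times the alpha derivative, so the stem
    derivative below equals the alpha derivative.\<close>
  then have B: "partial_beta F ?z = (- a2, a1)"
    unfolding A by (simp add: occ_imult_def prod_eq_iff eq_neg_iff_add_eq_0 add.commute)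
  have F'_Complex: "blinfun_apply F' (Complex p q) = p *\<^sub>R (a1, a2) + q *\<^sub>R (- a2, a1)" for p q
  proof -
    have "Complex p q = p *\<^sub>R 1 + q *\<^sub>R \<i>"
      by (simp add: complex_eq_iff)
    then show ?thesis
      using A B by (simp add: partial_eq_derivative[OF F'] blinfun.add_right blinfun.scaleR_right)
  qed
  have c: "slice_deriv D F x = a1 + K * a2"
    unfolding slice_deriv_def x slice_function_eq[OF stem_function_stem_deriv[OF f] K D]
    by (simp add: stem_deriv_def A B occ_imult_def scaleR_2[symmetric])
  have s: "spherical_deriv f x = b /\<^sub>R \<beta>"
    unfolding x b_def using spherical_deriv_eq[OF f K D] \<beta> by simp

  define \<rho> where "\<rho> y = norm (oct_Im y)" for y
  \<comment> \<open>Off the reals \<open>g\<close> is \<open>f\<close> in canonical coordinates: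
    every ingredient is a differentiable function of \<open>y\<close> near \<open>x\<close>.\<close>
  define g where "g y = fst (F (Complex (y \<bullet> 1) (\<rho> y))) +
    (oct_Im y /\<^sub>R \<rho> y) * snd (F (Complex (y \<bullet> 1) (\<rho> y)))" for y
  have Im_x: "oct_Im x = \<beta> *\<^sub>R K" "x \<bullet> 1 = \<alpha>"
    by (simp_all add: x oct_Im_slice[OF K])
  have \<rho>x: "\<rho> x = \<beta>"
    using \<beta> by (simp add: \<rho>_def Im_x imag_unit_props[OF K])
  have Im: "(oct_Im has_derivative oct_Im) (at y)" for y
    unfolding oct_Im_eq[abs_def] by (auto intro!: derivative_eq_intros)
  have "(norm has_derivative (\<lambda>h. h \<bullet> sgn (oct_Im x))) (at (oct_Im x))"
    using \<beta> imag_unit_props(2)[OF K] by (intro has_derivative_norm) (auto simp: Im_x)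
  moreover have "sgn (oct_Im x) = K"
    using \<beta> imag_unit_props(2)[OF K] by (simp add: Im_x sgn_div_norm)
  ultimately have "(norm has_derivative (\<lambda>h. h \<bullet> K)) (at (oct_Im x))"
    by simp
  from diff_chain_at[OF Im this] have "(\<rho> has_derivative (\<lambda>v. oct_Im v \<bullet> K)) (at x)"
    by (simp add: o_def \<rho>_def[abs_def])
  then have \<rho>: "(\<rho> has_derivative (\<lambda>v. v \<bullet> K)) (at x)"
    by (simp add: oct_Im_eq inner_diff_left imag_unit_inner[OF K])
  have "((\<lambda>y. Complex (y \<bullet> 1) (\<rho> y)) has_derivative (\<lambda>v. Complex (v \<bullet> 1) (v \<bullet> K))) (at x)"
    unfolding Complex_eq by (auto intro!: derivative_eq_intros \<rho>)
  from diff_chain_at[OF this, of F "blinfun_apply F'"] F'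
  have FF: "((\<lambda>y. F (Complex (y \<bullet> 1) (\<rho> y))) has_derivative
      (\<lambda>v. (v \<bullet> 1) *\<^sub>R (a1, a2) + (v \<bullet> K) *\<^sub>R (- a2, a1))) (at x)"
    by (simp add: Im_x \<rho>x o_def F'_Complex)
  \<comment> \<open>Normalization to the unit sphere differentiates to the projection tangent to the
    sphere, divided by the radius \<beta>.\<close>
  have "((\<lambda>y. oct_Im y /\<^sub>R \<rho> y) has_derivative (\<lambda>v. (oct_Im v - (v \<bullet> K) *\<^sub>R K) /\<^sub>R \<beta>)) (at x)"
    using \<beta> by (auto intro!: derivative_eq_intros Im \<rho> simp: \<rho>x Im_x fun_eq_iff algebra_simps)
  moreover have "oct_Im v - (v \<bullet> K) *\<^sub>R K = v - slice_proj K v" for v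
    by (simp add: oct_Im_eq slice_proj_def algebra_simps)
  ultimately have U: "((\<lambda>y. oct_Im y /\<^sub>R \<rho> y) has_derivative (\<lambda>v. (v - slice_proj K v) /\<^sub>R \<beta>)) (at x)"
    by simp
  have "(g has_derivative (\<lambda>v. fst ((v \<bullet> 1) *\<^sub>R (a1, a2) + (v \<bullet> K) *\<^sub>R (- a2, a1)) +
      ((oct_Im x /\<^sub>R \<rho> x) * snd ((v \<bullet> 1) *\<^sub>R (a1, a2) + (v \<bullet> K) *\<^sub>R (- a2, a1)) +
       ((v - slice_proj K v) /\<^sub>R \<beta>) * snd (F (Complex (x \<bullet> 1) (\<rho> x)))))) (at x)"
    unfolding g_def[abs_def]
    by (intro has_derivative_add has_derivative_fst has_derivative_snd FF
        bounded_bilinear.FDERIV[OF bounded_bilinear_octonion_mult] U)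
  \<comment> \<open>The \<open>a1\<close> and \<open>a2\<close> terms combine to
    \<open>slice_proj K v * (a1 + K * a2)\<close> because
    \<open>K * (K * a2) = - a2\<close>.\<close>
  moreover have "fst ((v \<bullet> 1) *\<^sub>R (a1, a2) + (v \<bullet> K) *\<^sub>R (- a2, a1)) +
      ((oct_Im x /\<^sub>R \<rho> x) * snd ((v \<bullet> 1) *\<^sub>R (a1, a2) + (v \<bullet> K) *\<^sub>R (- a2, a1)) +
       ((v - slice_proj K v) /\<^sub>R \<beta>) * snd (F (Complex (x \<bullet> 1) (\<rho> x)))) =
      slice_op K (slice_deriv D F x) (spherical_deriv f x) v" for v
    using \<beta> by (simp add: slice_op_def c s slice_proj_def \<rho>x Im_x b_def octonion_distrib
        octonion_mult_scaleR octonion_mult_diff octonion_mult_one imag_unit_mult_left[OF K]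
        algebra_simps)
  ultimately have g: "(g has_derivative slice_op K (slice_deriv D F x) (spherical_deriv f x)) (at x)"
    by simp
  have "continuous_on UNIV oct_Im"
    unfolding oct_Im_eq[abs_def] by (intro continuous_intros)
  then have "open (oct_Im -` (- {0}))"
    by (intro open_vimage) auto
  then have "open (circularization D \<inter> oct_Im -` (- {0}))"
    using f by (auto simp: slice_regular_def)
  then show ?thesis
  proof (rule has_derivative_transform_within_open[OF g])
    show "x \<in> circularization D \<inter> oct_Im -` (- {0})"
    proof
      show "x \<in> circularization D"
        using D K by (auto simp: circularization_def x)
      show "x \<in> oct_Im -` (- {0})"
        using \<beta> imag_unit_props(2)[OF K] by (auto simp: Im_x)
    qed
    fix y assume y: "y \<in> circularization D \<inter> oct_Im -` (- {0})"
    have "Complex (y \<bullet> 1) (\<rho> y) \<in> D"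
      using f y circularization_coords by (auto simp: slice_regular_def \<rho>_def)
    moreover have "oct_Im y /\<^sub>R \<rho> y \<in> imag_units"
      unfolding \<rho>_def using y by (intro normalized_Im_in_imag_units) simp
    moreover have "y = (y \<bullet> 1) *\<^sub>R 1 + \<rho> y *\<^sub>R (oct_Im y /\<^sub>R \<rho> y)"
      using y by (simp add: \<rho>_def) (simp add: oct_Im_eq)
    ultimately show "g y = f y"
      using slice_regular_eq[OF f] by (metis g_def)
  qed
qed

text \<open>The premise on \<open>oct_Im x\<^sub>0\<close> selects the half plane where
  \<open>std_almost_complex x\<^sub>0\<close> is \<open>Lmul J\<close>; in the opposite one it is
  \<open>Lmul (- J)\<close>, which would change the sign of the relation.\<close>

theorem theorem4p1:
  fixes D :: "complex set"
    and F :: "complex \<Rightarrow> octonion \<times> octonion"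
    and f :: "octonion \<Rightarrow> octonion"
    and J x\<^sub>0 c s :: octonion
    and A B :: "octonion set"
  assumes f: "slice_regular D F f"
    and J: "J \<in> imag_units"
    and x0: "x\<^sub>0 \<in> circularization D \<inter> slice_plane J" "x\<^sub>0 \<notin> oct_reals"
    and c_def: "c = slice_deriv D F x\<^sub>0"
    and s_def: "s = spherical_deriv f x\<^sub>0"
    and s_nonzero: "s \<noteq> 0"
    and c_s: "c * inverse s \<notin> (slice_plane J)\<^sup>\<bottom>"
    and A_def: "A = (\<lambda>z. z * c) ` slice_plane J"
    and B_def: "B = (\<lambda>z. z * s) ` (slice_plane J)\<^sup>\<bottom>"
  shows "direct_sum_decomposition A B \<and>
    f differentiable (at x\<^sub>0) \<and>
    orthogonal_complex_structure (Rmul s \<circ> Lmul J \<circ> Rmul (inverse s)) \<and>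
    orthogonal_complex_structure (Lmul J) \<and>
    (\<exists>!\<J>. \<forall>p\<in>A. \<forall>q\<in>B. \<J> (p + q) = J * p + (J * (q * inverse s)) * s) \<and>
    (\<forall>\<J>. (\<forall>p\<in>A. \<forall>q\<in>B. \<J> (p + q) = J * p + (J * (q * inverse s)) * s) \<longrightarrow>
       complex_structure \<J> \<and>
       (oct_Im x\<^sub>0 = norm (oct_Im x\<^sub>0) *\<^sub>R J \<longrightarrow>
          \<J> \<circ> frechet_derivative f (at x\<^sub>0) =
          frechet_derivative f (at x\<^sub>0) \<circ> std_almost_complex x\<^sub>0) \<and>
       (\<J> = Rmul s \<circ> Lmul J \<circ> Rmul (inverse s) \<longleftrightarrow> associator x\<^sub>0 c s = 0) \<and>
       (\<J> = Lmul J \<longleftrightarrow> s \<in> slice_plane J))"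
proof -
  let ?T = "slice_op J c s"
  obtain \<alpha> \<beta> where x: "x\<^sub>0 = \<alpha> *\<^sub>R 1 + \<beta> *\<^sub>R J"
    using x0(1) by (auto simp: slice_plane_def)
  have "\<beta> \<noteq> 0"
    using x0(2) by (auto simp: x oct_reals_def)
  have Im_x: "oct_Im x\<^sub>0 = \<beta> *\<^sub>R J" "x\<^sub>0 \<bullet> 1 = \<alpha>" "norm (oct_Im x\<^sub>0) = \<bar>\<beta>\<bar>"
    by (simp_all add: x oct_Im_slice[OF J] imag_unit_props[OF J])
  have D: "Complex \<alpha> \<bar>\<beta>\<bar> \<in> D"
    using f x0(1) circularization_coords[of D x\<^sub>0] by (simp add: slice_regular_def Im_x(2,3))
  have deriv: "(f has_derivative ?T) (at x\<^sub>0)"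
  proof (cases "\<beta> > 0")
    case True
    then show ?thesis
      using slice_regular_has_derivative[OF f J D] by (simp add: x c_def s_def)
  next
    case False
    \<comment> \<open>In the lower half plane the derivative is computed with the unit
      \<open>- J\<close> and the positive coordinate \<open>- \<beta>\<close>; the operator is the
      same.\<close>
    have "slice_op (- J) c s = ?T"
      by (simp add: slice_op_def slice_proj_minus fun_eq_iff)
    then show ?thesis
      using slice_regular_has_derivative[OF f minus_imag_units[OF J] D] False \<open>\<beta> \<noteq> 0\<close>
      by (simp add: x c_def s_def)
  qed
  have bij: "bij ?T"
    using bij_slice_op[OF J s_nonzero c_s] .
  have B: "B = (\<lambda>z. z * s) ` ((slice_plane J)\<^sup>\<bottom>)"
    unfolding B_def by (rule orthogonal_comp_mult_right[OF s_nonzero])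
  \<comment> \<open>As \<open>?T\<close> is onto, the intertwining relation determines the
    structure.\<close>
  have ext: "\<J> = \<K> \<longleftrightarrow> (\<forall>v. \<K> (?T v) = ?T (J * v))" if "\<forall>v. \<J> (?T v) = ?T (J * v)" for \<J> \<K>
  proof
    assume *: "\<forall>v. \<K> (?T v) = ?T (J * v)"
    show "\<J> = \<K>"
    proof
      fix x
      obtain v where "x = ?T v"
        using surjD[OF bij_is_surj[OF bij]] by blast
      then show "\<J> x = \<K> x"
        using that * by simp
    qed
  qed (use that in simp)
  have iff: "(\<forall>p\<in>A. \<forall>q\<in>B. \<J> (p + q) = J * p + (J * (q * inverse s)) * s) \<longleftrightarrow>
      (\<forall>v. \<J> (?T v) = ?T (J * v))" for \<J>
    unfolding A_def B by (rule slice_structure_iff_intertwines[OF J s_nonzero])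
  have "inv ?T (?T v) = v" for v
    using bij by (simp add: bij_is_inj)
  then have "\<exists>!\<J>. \<forall>v. \<J> (?T v) = ?T (J * v)"
    \<comment> \<open>The witness conjugates left multiplication by \<open>J\<close> with
      \<open>?T\<close>.\<close>
    by (intro ex1I[of _ "\<lambda>y. ?T (J * inv ?T y)"]) (simp_all add: ext)
  moreover have "complex_structure \<J>" if "\<forall>v. \<J> (?T v) = ?T (J * v)" for \<J>
    using complex_structure_if_intertwines[OF bij linear_slice_op J] that by blast
  moreover have "\<J> \<circ> frechet_derivative f (at x\<^sub>0) = frechet_derivative f (at x\<^sub>0) \<circ> std_almost_complex x\<^sub>0"
    if "\<forall>v. \<J> (?T v) = ?T (J * v)" "oct_Im x\<^sub>0 = norm (oct_Im x\<^sub>0) *\<^sub>R J" for \<J>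
  proof -
    have "oct_Im x\<^sub>0 /\<^sub>R norm (oct_Im x\<^sub>0) = J"
      using \<open>\<beta> \<noteq> 0\<close> by (subst that(2)) (simp add: Im_x(3))
    then show ?thesis
      using that(1) by (simp add: frechet_derivative_at[OF deriv, symmetric] fun_eq_iff std_almost_complex_def)
  qed
  moreover have "\<J> = Rmul s \<circ> Lmul J \<circ> Rmul (inverse s) \<longleftrightarrow> associator x\<^sub>0 c s = 0"
    if "\<forall>v. \<J> (?T v) = ?T (J * v)" for \<J>
    using \<open>\<beta> \<noteq> 0\<close> unfolding ext[OF that] intertwines_conj_iff[OF J s_nonzero]
    by (simp add: x associator_slice_plane_left)
  moreover have "\<J> = Lmul J \<longleftrightarrow> s \<in> slice_plane J" if "\<forall>v. \<J> (?T v) = ?T (J * v)" for \<J>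
    unfolding ext[OF that] by (rule intertwines_Lmul_iff[OF J])
  moreover have "direct_sum_decomposition A B"
    unfolding A_def B by (rule direct_sum_slice[OF J s_nonzero c_s])
  moreover have "f differentiable (at x\<^sub>0)"
    using deriv by (rule differentiableI)
  ultimately show ?thesis
    unfolding iff using orthogonal_complex_structure_Lmul[OF J]
      orthogonal_complex_structure_conj[OF J s_nonzero] by blast
qed

end
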